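(* Let $k \geq 2$ be an integer. Then the Laplacian spectrum of the non-commuting graph $\mathcal{A}_{PSL(2,2^k)}$ of the projective special linear group $PSL(2,2^k)$ (over the field with $2^k$ elements) is $$\{0, (2^{3k}-2^{k+1}-1)^{2^{3k-1}-2^{2k}+2^{k-1}}, (2^{3k}-2^{k+1})^{2^{2k}-2^k-2}, (2^{3k}-2^{k+1}+1)^{2^{3k-1}-2^{2k}-3\cdot 2^{k-1}}, (2^{3k}-2^k-1)^{2^{2k}+2^k}\}.$$
   Context: For a finite non-abelian group $G$ with centre $Z(G)$, the non-commuting graph $\mathcal{A}_G$ is the simple undirected graph with vertex set $G \setminus Z(G)$ in which two vertices $x,y$ are adjacent if and only if $xy \neq yx$. The Laplacian matrix of a finite graph is $D - A$, with $D$ the degree matrix and $A$ the adjacency matrix. The Laplacian spectrum is the multiset of eigenvalues of the Laplacian matrix; $\{\dots,\alpha^{a},\dots\}$ means the eigenvalue $\alpha$ is listed with multiplicity $a$ (not a power; no exponent means once, exponent $0$ means the entry is absent, and if listed values coincide their multiplicities add). *)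

theory Defs
  imports
    "HOL-Library.Cardinality"
    "HOL-Algebra.Coset"
    "Jordan_Normal_Form.Char_Poly"
    "Graph_Theory.Pair_Digraph"
begin

definition group_center :: "('a, 'm) monoid_scheme \<Rightarrow> 'a set" where
  "group_center G = {z \<in> carrier G. \<forall>g \<in> carrier G. z \<otimes>\<^bsub>G\<^esub> g = g \<otimes>\<^bsub>G\<^esub> z}"

lemma (in group) group_center_normal: "group_center G \<lhd> G"
proof -
  have "subgroup (group_center G) G"
  proof (rule subgroupI)
    show "group_center G \<subseteq> carrier G" by (auto simp: group_center_def)
    have "\<one> \<in> group_center G" by (auto simp: group_center_def)
    then show "group_center G \<noteq> {}" by blast
  next
    fix a assume a: "a \<in> group_center G"
    then have ac: "a \<in> carrier G" by (auto simp: group_center_def)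
    have "inv a \<otimes> g = g \<otimes> inv a" if g: "g \<in> carrier G" for g
    proof -
      have "a \<otimes> g = g \<otimes> a" using a g by (auto simp: group_center_def)
      then have "g = inv a \<otimes> (g \<otimes> a)"
        using ac g by (metis inv_solve_left m_closed)
      then have "g = (inv a \<otimes> g) \<otimes> a" using ac g by (simp add: m_assoc)
      then show ?thesis using ac g by (metis inv_closed inv_solve_right m_closed)
    qed
    then show "inv a \<in> group_center G" using ac by (auto simp: group_center_def)
  next
    fix a b assume "a \<in> group_center G" "b \<in> group_center G"
    then have ab: "a \<in> carrier G" "b \<in> carrier G"
      and a: "a \<otimes> g = g \<otimes> a" and b: "b \<otimes> g = g \<otimes> b" if "g \<in> carrier G" for g
      using that by (auto simp: group_center_def)
    have "(a \<otimes> b) \<otimes> g = g \<otimes> (a \<otimes> b)" if g: "g \<in> carrier G" for g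
    proof -
      have "(a \<otimes> b) \<otimes> g = a \<otimes> (g \<otimes> b)" using ab[OF g] b[OF g] g by (simp add: m_assoc)
      also have "\<dots> = (g \<otimes> a) \<otimes> b" using ab[OF g] a[OF g] g by (simp flip: m_assoc)
      finally show ?thesis using ab[OF g] g by (simp add: m_assoc)
    qed
    then show "a \<otimes> b \<in> group_center G" using ab[OF one_closed] by (simp add: group_center_def)
  qed
  moreover have "x \<otimes> h \<otimes> inv x \<in> group_center G"
    if "x \<in> carrier G" "h \<in> group_center G" for x h
  proof -
    have h: "h \<in> carrier G" "x \<otimes> h = h \<otimes> x" using that by (auto simp: group_center_def)
    then have "x \<otimes> h \<otimes> inv x = h" using that(1) by (simp add: m_assoc)
    then show ?thesis using that by simp
  qed
  ultimately show ?thesis by (auto simp: normal_inv_iff)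
qed

definition special_linear_group :: "nat \<Rightarrow> 'a::field mat monoid" ("SL") where
  "SL n = \<lparr>carrier = {A \<in> carrier_mat n n. det A = 1}, monoid.mult = (*), one = 1\<^sub>m n\<rparr>"

definition projective_special_linear_group :: "nat \<Rightarrow> 'a::field mat set monoid" ("PSL") where
  "PSL n = SL n Mod group_center (SL n)"

lemma group_SL: "group (SL n :: 'a::field mat monoid)"
proof (rule groupI)
  fix A :: "'a mat" assume "A \<in> carrier (SL n)"
  then have A: "A \<in> carrier_mat n n" and d: "det A = 1"
    by (auto simp: special_linear_group_def)
  have B: "adj_mat A \<in> carrier_mat n n" and BA: "adj_mat A * A = 1\<^sub>m n"
    using adj_mat[OF A] d by auto
  have "det (adj_mat A) = 1" using det_mult[OF B A] BA d by simp
  then show "\<exists>B \<in> carrier (SL n). B \<otimes>\<^bsub>SL n\<^esub> A = \<one>\<^bsub>SL n\<^esub>"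
    using B BA by (auto simp: special_linear_group_def)
qed (auto simp: special_linear_group_def det_mult)

lemma group_PSL: "group (PSL n :: 'a::field mat set monoid)"
  unfolding projective_special_linear_group_def
  by (intro normal.factorgroup_is_group group.group_center_normal group_SL)

text \<open>A simple undirected graph is a symmetric loop-free digraph without parallel arcs;
  each edge contributes both of its orientations as arcs.\<close>

definition noncommuting_graph :: "('a, 'm) monoid_scheme \<Rightarrow> 'a pair_pre_digraph" where
  "noncommuting_graph G =
    \<lparr>pverts = carrier G - group_center G,
     parcs = {(x, y). x \<in> carrier G - group_center G \<and> y \<in> carrier G - group_center G \<and>
                      x \<otimes>\<^bsub>G\<^esub> y \<noteq> y \<otimes>\<^bsub>G\<^esub> x}\<rparr>"

lemma pair_graph_noncommuting_graph:
  assumes "finite (carrier G)"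
  shows "pair_graph (noncommuting_graph G)"
proof
  have "parcs (noncommuting_graph G) \<subseteq> carrier G \<times> carrier G"
    by (auto simp: noncommuting_graph_def)
  then show "finite (parcs (noncommuting_graph G))"
    using assms by (rule finite_subset[OF _ finite_cartesian_product]) (rule assms)
  show "symmetric (noncommuting_graph G)"
    by (auto simp: symmetric_def sym_def noncommuting_graph_def)
qed (use assms in \<open>auto simp: noncommuting_graph_def\<close>)

text \<open>The list \<open>vs\<close> enumerates the vertices without repetition and thereby fixes the order
  of the rows and columns. In a symmetric digraph the out-degree is the number of neighbours.\<close>

definition degree_matrix :: "'v pair_pre_digraph \<Rightarrow> 'v list \<Rightarrow> 'b::ring_1 mat" where
  "degree_matrix G vs = mat (length vs) (length vs)
    (\<lambda>(i, j). if i = j then of_nat (out_degree (with_proj G) (vs ! i)) else 0)"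

definition adjacency_matrix :: "'v pair_pre_digraph \<Rightarrow> 'v list \<Rightarrow> 'b::ring_1 mat" where
  "adjacency_matrix G vs = mat (length vs) (length vs)
    (\<lambda>(i, j). if (vs ! i, vs ! j) \<in> parcs G then 1 else 0)"

definition laplacian_matrix :: "'v pair_pre_digraph \<Rightarrow> 'v list \<Rightarrow> 'b::ring_1 mat" where
  "laplacian_matrix G vs = degree_matrix G vs - adjacency_matrix G vs"

text \<open>Eigenvalues with their algebraic multiplicities. Taking them over the complex numbers
  makes the size of this multiset equal to the number of vertices.\<close>

definition laplacian_spectrum :: "'v pair_pre_digraph \<Rightarrow> 'v list \<Rightarrow> complex multiset" where
  "laplacian_spectrum G vs = proots (char_poly (laplacian_matrix G vs))"

lemma mem_laplacian_spectrum_iff: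
  "\<mu> \<in># laplacian_spectrum G vs \<longleftrightarrow> eigenvalue (laplacian_matrix G vs) \<mu>"
proof -
  have L: "(laplacian_matrix G vs :: complex mat) \<in> carrier_mat (length vs) (length vs)"
    unfolding laplacian_matrix_def degree_matrix_def adjacency_matrix_def
    by (intro minus_carrier_mat mat_carrier)
  have "char_poly (laplacian_matrix G vs :: complex mat) \<noteq> 0"
    using degree_monic_char_poly[OF L] by auto
  then show ?thesis
    by (simp add: laplacian_spectrum_def eigenvalue_root_char_poly[OF L])
qed

end

theory Submission
  imports Defs
begin

text \<open>Commuting is an equivalence relation on the non-central elements of
  \<open>PSL(2, q) = SL(2, q)\<close>, \<open>q\<close> even, so the non-commuting graph is complete multipartite and its
  Laplacian has an explicit eigenbasis; only the sizes of the classes matter. The centralizer of a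
  non-scalar matrix \<open>A\<close> of trace \<open>t\<close> consists of the \<open>x + y A\<close> with \<open>x\<^sup>2 + t x y + y\<^sup>2 = 1\<close>. If
  \<open>X\<^sup>2 + t X + 1\<close> has \<open>r\<close> roots, this equation has \<open>q + 1 - r\<close> solutions, because scaling
  spreads the nonzero values of the form evenly (squaring is bijective), so the class of \<open>A\<close>
  has \<open>q - r\<close> elements. Solving \<open>b c = a\<^sup>2 + t a + 1\<close> for each \<open>a\<close> shows that there are
  \<open>q (q - 1) + q r\<close> matrices of trace \<open>t\<close>. Finally \<open>r = 1\<close> only for \<open>t = 0\<close>, and since every
  \<open>x \<noteq> 0\<close> is a root for exactly one \<open>t\<close>, the cases \<open>r = 0\<close> and \<open>r = 2\<close> occur for \<open>q/2\<close> and
  \<open>q/2 - 1\<close> values of \<open>t\<close>.\<close>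

section \<open>The Laplacian spectrum of a complete multipartite graph\<close>

text \<open>The columns of \<open>P\<close> are eigenvectors. A one-sided inverse of a square matrix
  is two-sided, so \<open>L\<close> is similar to the diagonal matrix of the
  \<open>d i\<close>.\<close>

lemma char_poly_diagonalized:
  fixes L :: "'b::field mat"
  assumes "L \<in> carrier_mat n n" "P \<in> carrier_mat n n" "Q \<in> carrier_mat n n"
    and QP: "Q * P = 1\<^sub>m n" and LP: "L * P = P * mat_diag n d"
  shows "char_poly L = (\<Prod>i\<leftarrow>[0..<n]. [:- d i, 1:])"
proof -
  have D: "mat_diag n d \<in> carrier_mat n n" by simp
  have PQ: "P * Q = 1\<^sub>m n"
    using mat_mult_left_right_inverse[OF assms(3,2) QP] .
  have "P * mat_diag n d * Q = L * (P * Q)"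
    using LP assms(1-3) by (metis assoc_mult_mat)
  then have "L = P * mat_diag n d * Q"
    using PQ assms(1) by simp
  then have "similar_mat L (mat_diag n d)"
    using assms(1-3) D by (intro similar_matI[OF _ PQ QP]) (blast, assumption)
  then have "char_poly L = char_poly (mat_diag n d)"
    by (rule char_poly_similar)
  also have "\<dots> = (\<Prod>a\<leftarrow>diag_mat (mat_diag n d). [:- a, 1:])"
    by (rule char_poly_upper_triangular[OF D]) (auto simp: upper_triangular_def mat_diag_def)
  also have "diag_mat (mat_diag n d) = map d [0..<n]"
    by (auto simp: diag_mat_def mat_diag_def intro!: nth_equalityI)
  finally show ?thesis by (simp add: comp_def)
qed

lemma proots_prod_list_linear:
  "proots (\<Prod>x\<leftarrow>xs. [:- f x, 1 :: 'b::field:]) = image_mset f (mset xs)"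
proof (induction xs)
  case (Cons x xs)
  have "(\<Prod>x\<leftarrow>xs. [:- f x, 1:]) \<noteq> 0"
    by (auto simp: prod_list_zero_iff)
  then show ?case
    using Cons by (simp add: proots_mult del: mult_pCons_left)
qed simp

text \<open>Indexing by vertices instead of positions lets an eigenbasis be checked by sums over the
  vertex set: \<open>p\<close> holds the eigenvectors as columns, \<open>q\<close> is its inverse
  and \<open>d\<close> gives the eigenvalues.\<close>

lemma proots_char_poly_eigenbasis:
  fixes l p q :: "'v \<Rightarrow> 'v \<Rightarrow> 'b::field" and vs :: "'v list"
  defines "n \<equiv> length vs"
  assumes "distinct vs"
    and qp: "\<And>u w. u \<in> set vs \<Longrightarrow> w \<in> set vs \<Longrightarrow>
      (\<Sum>v\<in>set vs. q u v * p v w) = (if u = w then 1 else 0)"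
    and lp: "\<And>u w. u \<in> set vs \<Longrightarrow> w \<in> set vs \<Longrightarrow>
      (\<Sum>v\<in>set vs. l u v * p v w) = p u w * d w"
  shows "proots (char_poly (mat n n (\<lambda>(i, j). l (vs ! i) (vs ! j)))) =
    image_mset d (mset_set (set vs))"
proof -
  define M where "M = (\<lambda>f::'v \<Rightarrow> 'v \<Rightarrow> 'b. mat n n (\<lambda>(i, j). f (vs ! i) (vs ! j)))"
  have [simp]: "M f \<in> carrier_mat n n" for f by (simp add: M_def)
  have bij: "bij_betw (\<lambda>i. vs ! i) {0..<n} (set vs)"
    by (rule bij_betw_nth[OF \<open>distinct vs\<close>]) (auto simp: n_def)
  have prod: "M f * M g = M (\<lambda>u w. \<Sum>v\<in>set vs. f u v * g v w)" for f g
  proof (rule eq_matI)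
    fix i j assume "i < dim_row (M (\<lambda>u w. \<Sum>v\<in>set vs. f u v * g v w))"
      "j < dim_col (M (\<lambda>u w. \<Sum>v\<in>set vs. f u v * g v w))"
    then have ij: "i < n" "j < n" by (auto simp: M_def)
    have "(M f * M g) $$ (i, j) = (\<Sum>k\<in>{0..<n}. f (vs ! i) (vs ! k) * g (vs ! k) (vs ! j))"
      using ij by (simp add: M_def scalar_prod_def)
    also have "\<dots> = (\<Sum>v\<in>set vs. f (vs ! i) v * g v (vs ! j))"
      by (rule sum.reindex_bij_betw[OF bij])
    finally show "(M f * M g) $$ (i, j) = M (\<lambda>u w. \<Sum>v\<in>set vs. f u v * g v w) $$ (i, j)"
      using ij by (simp add: M_def)
  qed (auto simp: M_def)
  have mem: "vs ! i \<in> set vs" if "i < n" for i using that by (simp add: n_def)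
  have "M q * M p = 1\<^sub>m n"
    unfolding prod
    by (rule eq_matI) (use mem \<open>distinct vs\<close> in
        \<open>auto simp: M_def qp n_def nth_eq_iff_index_eq\<close>)
  moreover have "M l * M p = M p * mat_diag n (\<lambda>i. d (vs ! i))"
    unfolding prod
    by (subst mat_diag_mult_right[of _ n], simp, rule eq_matI)
      (use mem in \<open>auto simp: M_def lp\<close>)
  ultimately have "char_poly (M l) = (\<Prod>i\<leftarrow>[0..<n]. [:- d (vs ! i), 1:])"
    by (intro char_poly_diagonalized[where P = "M p" and Q = "M q"]) auto
  also have "\<dots> = prod_list (map (\<lambda>v. [:- d v, 1:]) vs)"
    by (rule arg_cong[where f = prod_list]) (auto simp: n_def intro!: nth_equalityI)
  finally show ?thesis
    using \<open>distinct vs\<close> by (simp add: M_def proots_prod_list_linear mset_set_set)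
qed

section \<open>The Laplacian of a complete multipartite graph and its eigenvalues\<close>

lemma laplacian_matrix_entries:
  fixes G :: "'v pair_pre_digraph"
  assumes "\<And>v. v \<in> set vs \<Longrightarrow> out_degree (with_proj G) v = deg v"
    and "\<And>v. (v, v) \<notin> parcs G"
  shows "laplacian_matrix G vs = (mat (length vs) (length vs)
    (\<lambda>(i, j). (if i = j then of_nat (deg (vs ! i)) else 0)
      - (if (vs ! i, vs ! j) \<in> parcs G then 1 else 0)) :: 'b::ring_1 mat)"
  unfolding laplacian_matrix_def degree_matrix_def adjacency_matrix_def
  by (rule eq_matI) (use assms in auto)

lemma image_mset_mset_set_eq_sum: "finite A \<Longrightarrow> image_mset f (mset_set A) = (\<Sum>x\<in>A. {#f x#})"
  by (induction A rule: finite_induct) auto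

lemma sum_constant_mset: "(\<Sum>x\<in>A. M) = repeat_mset (card A) (M :: 'a multiset)"
  by (induction A rule: infinite_finite_induct) auto

lemma repeat_replicate_mset: "repeat_mset n (replicate_mset m x) = replicate_mset (n * m) x"
  by (rule multiset_eqI) simp

text \<open>Distinct fibres are disjoint. This recovers the number of classes of a given size from
  the number of elements lying in them.\<close>

lemma count_by_fibre_size:
  fixes f :: "'v \<Rightarrow> 'c" and V :: "'v set"
  defines "m \<equiv> \<lambda>x. card {v \<in> V. f v = x}"
  assumes "finite V"
  shows "card {v \<in> V. m (f v) = s} = card {x \<in> f ` V. m x = s} * s"
proof -
  have "{v \<in> V. m (f v) = s} = (\<Union>x\<in>{x \<in> f ` V. m x = s}. {v \<in> V. f v = x})"
    by auto
  also have "card \<dots> = (\<Sum>x\<in>{x \<in> f ` V. m x = s}. card {v \<in> V. f v = x})"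
    using \<open>finite V\<close> by (intro card_UN_disjoint) auto
  also have "\<dots> = (\<Sum>x\<in>{x \<in> f ` V. m x = s}. s)"
    by (intro sum.cong) (auto simp: m_def)
  finally show ?thesis by simp
qed

text \<open>With \<open>N\<close> vertices, constants have eigenvalue 0, vectors constant on classes
  with total 0 have eigenvalue \<open>N\<close>, and vectors supported on a class of size
  \<open>m x\<close> with total 0 have eigenvalue \<open>N - m x\<close>. The dimensions are 1, the
  number of classes minus 1, and \<open>m x - 1\<close> for each class.\<close>

theorem laplacian_spectrum_complete_multipartite:
  fixes G :: "'v pair_pre_digraph" and part :: "'v \<Rightarrow> 'c"
  defines "m \<equiv> \<lambda>x. card {v \<in> pverts G. part v = x}"
  assumes dist: "distinct vs" and vs: "set vs = pverts G" and ne: "pverts G \<noteq> {}"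
    and arcs: "parcs G = {(u, v). u \<in> pverts G \<and> v \<in> pverts G \<and> part u \<noteq> part v}"
  shows "laplacian_spectrum G vs = {#0#}
    + replicate_mset (card (part ` pverts G) - 1) (of_nat (card (pverts G)))
    + (\<Sum>x\<in>part ` pverts G. replicate_mset (m x - 1) (of_nat (card (pverts G)) - of_nat (m x)))"
proof -
  define V where "V = pverts G"
  define N :: complex where "N = of_nat (card V)"
  define M :: "'v \<Rightarrow> complex" where "M = (\<lambda>u. of_nat (m (part u)))"
  define rep where "rep = inv_into V part"
  obtain v1 where v1: "v1 \<in> V" using ne by (auto simp: V_def)
  \<comment> \<open>Since \<open>v0\<close> is itself a representative, the three kinds of
    eigenvectors can be indexed by \<open>v0\<close>, the other representatives and the remaining
    vertices.\<close>
  define v0 where "v0 = rep (part v1)"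
  have finV: "finite V" using vs by (auto simp: V_def simp flip: vs)
  have rep: "rep x \<in> V" "part (rep x) = x" if "x \<in> part ` V" for x
    using that by (auto simp: rep_def inv_into_into f_inv_into_f)
  have v0: "v0 \<in> V" "rep (part v0) = v0"
    using v1 rep by (auto simp: v0_def)
  have N0: "N \<noteq> 0" using v1 finV by (auto simp: N_def)
  have M0: "M u \<noteq> 0" if "u \<in> V" for u
    using that finV by (auto simp: M_def m_def V_def)
  have Msum: "(\<Sum>v\<in>V. if part v = part u then 1 else 0) = M u" for u
    using finV by (simp add: M_def m_def sum.If_cases V_def Int_def)
  have Msum': "(\<Sum>v\<in>V. if part u = part v then 1 else 0) = M u" for u
    using Msum[of u] by (simp add: eq_commute)
  have part_cong: "M u = M w" if "part u = part w" for u w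
    using that by (simp add: M_def)

  \<comment> \<open>Columns of \<open>p\<close>: the all-one vector, the differences of normalised class indicators, and
    the differences of unit vectors inside a class. The rows of \<open>q\<close> are the dual functionals.\<close>
  define l where "l = (\<lambda>u v. (if u = v then N - M u else 0) - (if part u \<noteq> part v then 1 else 0))"
  define p where "p = (\<lambda>v w. if w = v0 then 1
    else if w = rep (part w) then (if part v = part w then 1 else 0) / M w
      - (if part v = part v0 then 1 else 0) / M v0
    else (if v = w then 1 else 0) - (if v = rep (part w) then 1 else 0))"
  define q where "q = (\<lambda>u v. if u = v0 then 1 / N
    else if u = rep (part u) then (if part u = part v then 1 else 0) - M u / N
    else (if v = u then 1 else 0) - (if part u = part v then 1 else 0) / M u)"
  define d where "d = (\<lambda>w. if w = v0 then 0 else if w = rep (part w) then N else N - M w)"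

  \<comment> \<open>The rows of \<open>q\<close> and \<open>l\<close> act only through total sums,
    class sums and single entries, so it suffices to evaluate the first two on the columns of
    \<open>p\<close>.\<close>
  have total: "(\<Sum>v\<in>V. p v w) = (if w = v0 then N else 0)" if "w \<in> V" for w
    using that finV M0 v0 rep
    by (cases "w = v0"; cases "w = rep (part w)")
      (simp_all add: p_def N_def sum_subtractf Msum flip: sum_divide_distrib)
  have class_total: "(\<Sum>v\<in>V. if part u = part v then p v w else 0) =
      (if w = v0 then M u else if w = rep (part w)
       then (if part u = part w then 1 else 0) - (if part u = part v0 then 1 else 0) else 0)"
    if "u \<in> V" "w \<in> V" for u w
  proof -
    consider "w = v0" | "w \<noteq> v0" "w = rep (part w)" | "w \<noteq> v0" "w \<noteq> rep (part w)" by blast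
    then show ?thesis
    proof cases
      case 1
      then have "(\<Sum>v\<in>V. if part u = part v then p v w else 0) =
        (\<Sum>v\<in>V. if part u = part v then 1 else 0)"
        by (intro sum.cong) (auto simp: p_def)
      then show ?thesis using 1 by (simp add: Msum')
    next
      case 2
      have "(\<Sum>v\<in>V. if part u = part v then p v w else 0) =
        (\<Sum>v\<in>V. (if part u = part w then (if part v = part w then 1 else 0) / M w else 0)
          - (if part u = part v0 then (if part v = part v0 then 1 else 0) / M v0 else 0))"
        using 2 by (intro sum.cong) (auto simp: p_def)
      also have "\<dots> = (if part u = part w then 1 else 0) - (if part u = part v0 then 1 else 0)"
        using M0 v0 that part_cong[of u w] part_cong[of u v0]
        by (auto simp: sum_subtractf Msum simp flip: sum_divide_distrib)
      finally show ?thesis using 2 by simp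
    next
      case 3
      have "(\<Sum>v\<in>V. if part u = part v then p v w else 0) =
        (\<Sum>v\<in>V. (if v = w then (if part u = part w then 1 else 0) else 0)
          - (if v = rep (part w) then (if part u = part w then 1 else 0) else 0))"
        using 3 rep that by (intro sum.cong) (auto simp: p_def)
      also have "\<dots> = 0"
        using that rep finV by (auto simp: sum_subtractf)
      finally show ?thesis using 3 by simp
    qed
  qed

  have qp: "(\<Sum>v\<in>V. q u v * p v w) = (if u = w then 1 else 0)" if "u \<in> V" "w \<in> V" for u w
  proof -
    consider "u = v0" | "u \<noteq> v0" "u = rep (part u)" | "u \<noteq> v0" "u \<noteq> rep (part u)" by blast
    then show ?thesis
    proof cases
      case 1
      then show ?thesis
        using total[OF \<open>w \<in> V\<close>] N0 by (simp add: q_def flip: sum_divide_distrib)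
    next
      case 2
      have "(\<Sum>v\<in>V. q u v * p v w) =
        (\<Sum>v\<in>V. (if part u = part v then p v w else 0) - M u / N * p v w)"
        using 2 by (intro sum.cong) (auto simp: q_def algebra_simps)
      also have "\<dots> = (\<Sum>v\<in>V. if part u = part v then p v w else 0)
          - M u / N * (\<Sum>v\<in>V. p v w)"
        by (simp add: sum_subtractf sum_distrib_left)
      also have "\<dots> = (if u = w then 1 else 0)"
        using 2 v0 N0 unfolding class_total[OF that] total[OF \<open>w \<in> V\<close>] by auto
      finally show ?thesis .
    next
      case 3
      have "(\<Sum>v\<in>V. q u v * p v w) =
        (\<Sum>v\<in>V. (if v = u then p u w else 0) - (if part u = part v then p v w else 0) / M u)"
        using 3 by (intro sum.cong) (auto simp: q_def algebra_simps)
      also have "\<dots> = p u w - (\<Sum>v\<in>V. if part u = part v then p v w else 0) / M u"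
        using finV that by (simp add: sum_subtractf sum_divide_distrib)
      also have "\<dots> = (if u = w then 1 else 0)"
        using 3 v0 M0[OF \<open>u \<in> V\<close>] rep that part_cong[of u w] part_cong[of u v0] unfolding class_total[OF that]
        by (auto simp: p_def)
      finally show ?thesis .
    qed
  qed

  have lp: "(\<Sum>v\<in>V. l u v * p v w) = p u w * d w" if "u \<in> V" "w \<in> V" for u w
  proof -
    \<comment> \<open>Row \<open>u\<close> of the Laplacian is \<open>N - M u\<close> times
      evaluation at \<open>u\<close>, minus the total sum, plus the sum over the class of
      \<open>u\<close>.\<close>
    have "(\<Sum>v\<in>V. l u v * p v w) =
      (\<Sum>v\<in>V. (if v = u then (N - M u) * p u w else 0) - p v w
        + (if part u = part v then p v w else 0))"
      by (intro sum.cong) (auto simp: l_def)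
    also have "\<dots> = (N - M u) * p u w - (\<Sum>v\<in>V. p v w)
        + (\<Sum>v\<in>V. if part u = part v then p v w else 0)"
      using finV that by (simp add: sum_subtractf sum.distrib)
    also have "\<dots> = p u w * d w"
      using v0 rep M0[OF \<open>u \<in> V\<close>] M0[OF \<open>w \<in> V\<close>] M0[OF v0(1)] that
        part_cong[of u w] part_cong[of u v0] unfolding class_total[OF that] total[OF \<open>w \<in> V\<close>]
      by (auto simp: p_def d_def field_simps)
    finally show ?thesis .
  qed

  have deg: "out_degree (with_proj G) v = card V - m (part v)" if "v \<in> set vs" for v
  proof -
    have "out_arcs (with_proj G) v = Pair v ` (V - {w \<in> V. part w = part v})"
      using that vs arcs by (auto simp: out_arcs_def V_def)
    then show ?thesis
      using finV by (simp add: out_degree_def card_image inj_on_def card_Diff_subset m_def V_def)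
  qed
  have "m x \<le> card V" for x
    unfolding m_def V_def[symmetric] by (rule card_mono) (use finV in auto)
  then have "laplacian_matrix G vs =
      mat (length vs) (length vs) (\<lambda>(i, j). l (vs ! i) (vs ! j))"
    by (subst laplacian_matrix_entries[OF deg])
      (use arcs nth_mem[of _ vs] vs dist in \<open>auto simp: l_def N_def M_def nth_eq_iff_index_eq of_nat_diff
         intro!: eq_matI\<close>)
  then have "laplacian_spectrum G vs = image_mset d (mset_set V)"
    unfolding laplacian_spectrum_def
    using proots_char_poly_eigenbasis[OF dist, of q p l d] qp lp vs by (simp add: V_def)
  also have "\<dots> = (\<Sum>v\<in>V. {#d v#})"
    using finV by (rule image_mset_mset_set_eq_sum)
  \<comment> \<open>Grouping by classes separates the representative, whose eigenvalue is 0 or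
    \<open>N\<close>, from the other members, whose eigenvalue depends only on the class
    size.\<close>
  also have "\<dots> = (\<Sum>x\<in>part ` V. \<Sum>v\<in>{v \<in> V. part v = x}. {#d v#})"
    using finV by (rule sum.image_gen)
  also have "\<dots> = (\<Sum>x\<in>part ` V. {#d (rep x)#} + replicate_mset (m x - 1) (N - of_nat (m x)))"
  proof (rule sum.cong[OF refl])
    fix x assume x: "x \<in> part ` V"
    have "(\<Sum>v\<in>{v \<in> V. part v = x}. {#d v#}) =
        {#d (rep x)#} + (\<Sum>v\<in>{v \<in> V. part v = x} - {rep x}. {#d v#})"
      by (rule sum.remove) (use finV rep[OF x] in auto)
    also have "(\<Sum>v\<in>{v \<in> V. part v = x} - {rep x}. {#d v#}) =
        (\<Sum>v\<in>{v \<in> V. part v = x} - {rep x}. {#N - of_nat (m x)#})"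
      using v0 by (intro sum.cong) (auto simp: d_def M_def)
    also have "\<dots> = replicate_mset (m x - 1) (N - of_nat (m x))"
      using finV rep[OF x] by (simp add: sum_constant_mset m_def V_def)
    finally show "(\<Sum>v\<in>{v \<in> V. part v = x}. {#d v#}) =
        {#d (rep x)#} + replicate_mset (m x - 1) (N - of_nat (m x))" .
  qed
  also have "\<dots> = (\<Sum>x\<in>part ` V. {#d (rep x)#})
      + (\<Sum>x\<in>part ` V. replicate_mset (m x - 1) (N - of_nat (m x)))"
    by (rule sum.distrib)
  also have "(\<Sum>x\<in>part ` V. {#d (rep x)#}) =
      {#d v0#} + (\<Sum>x\<in>part ` V - {part v0}. {#d (rep x)#})"
    using finV v0 by (subst sum.remove[of _ "part v0"]) auto
  also have "(\<Sum>x\<in>part ` V - {part v0}. {#d (rep x)#}) = (\<Sum>x\<in>part ` V - {part v0}. {#N#})"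
    by (intro sum.cong) (use rep in \<open>auto simp: d_def\<close>)
  also have "\<dots> = replicate_mset (card (part ` V) - 1) N"
    using finV v0 by (simp add: sum_constant_mset)
  finally show ?thesis
    by (simp add: d_def N_def V_def)
qed

section \<open>Finite fields of characteristic 2\<close>

text \<open>The shift by 1 permutes the field, so comparing the sums of all elements makes the field
  size 0 in the field; a power of 2 vanishes only if 2 does.\<close>

lemma card_eq_power_2_imp_two_eq_0:
  assumes "CARD('a::field) = 2 ^ k"
  shows "(2 :: 'a) = 0"
proof -
  have fin: "finite (UNIV :: 'a set)"
    by (rule card_ge_0_finite) (simp add: assms)
  have "(\<Sum>x\<in>UNIV. x + 1) = (\<Sum>x\<in>(UNIV :: 'a set). x)"
    by (rule sum.reindex_bij_witness[of _ "\<lambda>x. x - 1" "\<lambda>x. x + 1"]) auto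
  then have "of_nat CARD('a) = (0 :: 'a)"
    by (simp add: sum.distrib)
  then show ?thesis by (simp add: assms)
qed

text \<open>In characteristic 2 this counts the distinct eigenvalues, lying in the field, of a 2 by
  2 matrix of determinant 1 and trace \<open>t\<close>.\<close>

definition trace_roots :: "'a::field \<Rightarrow> nat" where
  "trace_roots t = card {x. x\<^sup>2 + t * x + 1 = 0}"

locale finite_field_char_2 =
  fixes field_type :: "'a::field itself" and q :: nat
  assumes finite_UNIV: "finite (UNIV :: 'a set)" and q_def: "q = CARD('a)"
    and two_eq_0: "(2 :: 'a) = 0"
begin

lemma q_gt_1: "q > 1"
proof -
  have "card {0, 1 :: 'a} \<le> q"
    unfolding q_def by (rule card_mono[OF finite_UNIV]) auto
  then show ?thesis by simp
qed

lemma finite_field_set [simp]: "finite (A :: 'a set)"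
  by (rule finite_subset[OF subset_UNIV finite_UNIV])

lemma double_eq_0 [simp]: "x + x = (0 :: 'a)"
  using two_eq_0 by (metis mult_2 mult_zero_left)

lemma uminus_eq_self [simp]: "- x = (x :: 'a)"
  using double_eq_0 by (rule add.inverse_unique)

lemma minus_eq_plus [simp]: "x - y = x + (y :: 'a)"
  by (metis diff_conv_add_uminus uminus_eq_self)

lemma add_self_cancel [simp]: "x + (x + y) = (y :: 'a)"
  by (simp flip: add.assoc)

lemma add_eq_0_iff_eq: "x + y = 0 \<longleftrightarrow> x = (y :: 'a)"
  by (metis add_eq_0_iff uminus_eq_self)

lemma square_add: "(x + y)\<^sup>2 = x\<^sup>2 + (y :: 'a)\<^sup>2"
  by (simp add: power2_eq_square algebra_simps)

lemma square_eq_iff: "x\<^sup>2 = y\<^sup>2 \<longleftrightarrow> x = (y :: 'a)"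
proof
  assume "x\<^sup>2 = y\<^sup>2"
  then have "(x + y)\<^sup>2 = 0" by (simp add: square_add)
  then show "x = y" by (simp add: add_eq_0_iff_eq)
qed simp

text \<open>Squaring is injective in characteristic 2, hence surjective on a finite field.\<close>

lemma obtain_sqrt:
  obtains s where "s\<^sup>2 = (x :: 'a)"
proof -
  have "inj (\<lambda>s::'a. s\<^sup>2)" by (auto simp: inj_def square_eq_iff)
  then have "surj (\<lambda>s::'a. s\<^sup>2)" using finite_UNIV by (simp add: finite_UNIV_inj_surj)
  then show thesis using that by (metis surjD)
qed

section \<open>Roots of the polynomials X^2 + t X + 1\<close>

lemma trace_roots_0: "trace_roots (0 :: 'a) = 1"
proof -
  have "{x. x\<^sup>2 + 0 * x + 1 = 0} = {1 :: 'a}"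
    using square_eq_iff[of _ 1] by (auto simp: add_eq_0_iff_eq)
  then show ?thesis by (simp add: trace_roots_def)
qed

text \<open>The roots have sum \<open>t\<close>, so a root \<open>r\<close> has the partner
  \<open>r + t\<close>, which differs from it because \<open>t\<close> is nonzero.\<close>

lemma trace_roots_nonzero:
  fixes t :: 'a
  assumes "t \<noteq> 0"
  shows "trace_roots t = 0 \<or> trace_roots t = 2"
proof (cases "\<exists>r. r\<^sup>2 + t * r + 1 = 0")
  case True
  then obtain r where r: "r\<^sup>2 + t * r + 1 = 0" by blast
  have "x\<^sup>2 + t * x + 1 = 0 \<longleftrightarrow> x = r \<or> x = r + t" for x
  proof -
    have "x\<^sup>2 + t * x + 1 = (x\<^sup>2 + t * x + 1) + (r\<^sup>2 + t * r + 1)" using r by simp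
    also have "\<dots> = (x + r) * (x + r + t)"
      by (simp add: power2_eq_square algebra_simps)
    finally show ?thesis by (simp add: add_eq_0_iff_eq add.assoc)
  qed
  then have "{x. x\<^sup>2 + t * x + 1 = 0} = {r, r + t}" by auto
  then show ?thesis using assms by (simp add: trace_roots_def)
next
  case False
  then show ?thesis by (simp add: trace_roots_def)
qed

text \<open>A nonzero \<open>x\<close> is a root for exactly one trace, \<open>x + 1 / x\<close>,
  and 0 is never a root; so pairs of a trace and a root correspond to nonzero elements.\<close>

lemma sum_trace_roots: "(\<Sum>t\<in>(UNIV :: 'a set). trace_roots t) = q - 1"
proof -
  have "(\<Sum>t\<in>(UNIV :: 'a set). trace_roots t) =
      card (SIGMA t:UNIV. {x :: 'a. x\<^sup>2 + t * x + 1 = 0})"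
    by (simp add: trace_roots_def)
  also have "\<dots> = card (UNIV - {0 :: 'a})"
  proof (rule bij_betw_same_card)
    have t_eq: "x + 1 / x = t \<and> x \<noteq> 0" if "x\<^sup>2 + t * x + 1 = 0" for t x :: 'a
    proof -
      have "x \<noteq> 0" using that by auto
      have "x\<^sup>2 + 1 = t * x" using that by (metis add.assoc add.commute add_eq_0_iff_eq)
      then have "x * (x + 1 / x) = x * t"
        using \<open>x \<noteq> 0\<close> by (simp add: power2_eq_square distrib_left mult.commute)
      then show ?thesis using \<open>x \<noteq> 0\<close> by simp
    qed
    have root: "x\<^sup>2 + (x + 1 / x) * x + 1 = 0" if "x \<noteq> 0" for x :: 'a
      using that by (simp add: power2_eq_square distrib_right add.assoc)
    show "bij_betw snd (SIGMA t:UNIV. {x :: 'a. x\<^sup>2 + t * x + 1 = 0}) (UNIV - {0})"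
    proof (rule bij_betwI[of _ _ _ "\<lambda>x. (x + 1 / x, x)"])
      show "snd \<in> (SIGMA t:UNIV. {x :: 'a. x\<^sup>2 + t * x + 1 = 0}) \<rightarrow> UNIV - {0}"
      proof
        show "snd v \<in> UNIV - {0}" if "v \<in> (SIGMA t:UNIV. {x :: 'a. x\<^sup>2 + t * x + 1 = 0})" for v
          using t_eq[of "snd v" "fst v"] that by (cases v) simp
      qed
      show "(\<lambda>x. (x + 1 / x, x)) \<in> UNIV - {0} \<rightarrow> (SIGMA t:UNIV. {x :: 'a. x\<^sup>2 + t * x + 1 = 0})"
      proof
        show "(x + 1 / x, x) \<in> (SIGMA t:UNIV. {x :: 'a. x\<^sup>2 + t * x + 1 = 0})" if "x \<in> UNIV - {0}" for x
          using root[of x] that by (intro SigmaI CollectI) blast+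
      qed
      show "(snd v + 1 / snd v, snd v) = v"
        if "v \<in> (SIGMA t:UNIV. {x :: 'a. x\<^sup>2 + t * x + 1 = 0})" for v
        using t_eq[of "snd v" "fst v"] that by (cases v) simp
    qed simp
  qed
  finally show ?thesis by (simp add: q_def card_Diff_subset)
qed

text \<open>Let n0 and n2 count the traces with 0 and 2 roots. Counting traces gives 1 + n0 + n2 =
  q, counting roots gives 1 + 2 n2 = q - 1; the 1 on the left is trace 0.\<close>

lemma card_traces:
  "2 * card {t :: 'a. trace_roots t = 2} + 2 = q"
  "card {t :: 'a. trace_roots t = 0} = card {t :: 'a. trace_roots t = 2} + 1"
proof -
  have T1: "trace_roots t = 1 \<longleftrightarrow> t = 0" for t :: 'a
    using trace_roots_0 trace_roots_nonzero by fastforce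
  have "q = (\<Sum>t\<in>(UNIV :: 'a set). 1)"
    by (simp add: q_def)
  also have "\<dots> = (\<Sum>t\<in>(UNIV :: 'a set). of_bool (t = 0) + of_bool (trace_roots t = 0)
      + of_bool (trace_roots t = 2))"
    using trace_roots_0 trace_roots_nonzero by (intro sum.cong) (force simp: of_bool_def)+
  also have "\<dots> = 1 + card {t :: 'a. trace_roots t = 0} + card {t :: 'a. trace_roots t = 2}"
    by (simp add: sum.distrib of_bool_def sum.If_cases)
  finally have q: "q = \<dots>" .
  have "q - 1 = (\<Sum>t\<in>(UNIV :: 'a set). of_bool (t = 0) + 2 * of_bool (trace_roots t = 2))"
    unfolding sum_trace_roots[symmetric]
    using trace_roots_0 trace_roots_nonzero by (intro sum.cong) (force simp: of_bool_def)+
  also have "\<dots> = 1 + 2 * card {t :: 'a. trace_roots t = 2}"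
    by (simp add: sum.distrib of_bool_def sum.If_cases flip: sum_distrib_left)
  finally show "2 * card {t :: 'a. trace_roots t = 2} + 2 = q"
    "card {t :: 'a. trace_roots t = 0} = card {t :: 'a. trace_roots t = 2} + 1"
    using q q_gt_1 by auto
qed

text \<open>Splitting the plane by the value of the form gives q^2 = (q - 1) c + 1 + (q - 1) r, with
  c vectors of value 1 and r roots; then q - 1 cancels.\<close>

lemma card_norm_eq_1:
  "card {(x, y). x\<^sup>2 + t * x * y + y\<^sup>2 = (1 :: 'a)} + trace_roots t = q + 1"
proof -
  define n where "n = (\<lambda>(x, y). x\<^sup>2 + t * x * y + (y :: 'a)\<^sup>2)"
  have fin [simp]: "finite (A :: ('a \<times> 'a) set)" for A
    by (rule finite_subset[OF subset_UNIV]) (intro finite_Prod_UNIV finite_UNIV)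
  have n_scale: "n (s * x, s * y) = s\<^sup>2 * n (x, y)" for s x y
    by (simp add: n_def power2_eq_square algebra_simps)
  \<comment> \<open>A vector of nonzero value is a unique multiple of a vector of value 1: the
    factor is the square root of the value.\<close>
  have "bij_betw (\<lambda>(s, x, y). (s * x, s * y)) ((UNIV - {0}) \<times> {v. n v = 1}) {v. n v \<noteq> 0}"
  proof (rule bij_betw_imageI)
    have inj: "(s, x, y) = (s', x', y')"
      if "s \<noteq> 0" "n (x, y) = 1" "n (x', y') = 1" "s * x = s' * x'" "s * y = s' * y'" for s x y s' x' y'
    proof -
      have "s\<^sup>2 * 1 = s'\<^sup>2 * 1" using n_scale that by metis
      then have "s = s'" by (simp add: square_eq_iff)
      then show ?thesis using that by auto
    qed
    show "inj_on (\<lambda>(s, x, y). (s * x, s * y)) ((UNIV - {0}) \<times> {v. n v = 1})"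
      by (rule inj_onI, elim SigmaE, hypsubst, unfold split_paired_all split_conv)
        (rule inj, auto)
    have "\<exists>s x' y'. s \<noteq> 0 \<and> n (x', y') = 1 \<and> x = s * x' \<and> y = s * y'" if "n (x, y) \<noteq> 0" for x y
    proof -
      obtain s where s: "s\<^sup>2 = n (x, y)" by (rule obtain_sqrt)
      with that have "s \<noteq> 0" by auto
      moreover have "n (x / s, y / s) = 1"
        using n_scale[of "1 / s" x y] s that by (simp add: power_divide)
      ultimately show ?thesis by (intro exI[of _ s] exI[of _ "x / s"] exI[of _ "y / s"]) auto
    qed
    then have "v \<in> (\<lambda>(s, x, y). (s * x, s * y)) ` ((UNIV - {0}) \<times> {v. n v = 1})" if "n v \<noteq> 0" for v
      using that by (cases v) (fastforce simp: image_iff)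
    then show "(\<lambda>(s, x, y). (s * x, s * y)) ` ((UNIV - {0}) \<times> {v. n v = 1}) = {v. n v \<noteq> 0}"
      by (auto simp: n_scale)
  qed
  then have nonzero: "card {v. n v \<noteq> 0} = (q - 1) * card {v. n v = 1}"
    by (auto dest!: bij_betw_same_card simp: card_cartesian_product q_def card_Diff_subset)
  have n_root: "n (r * y, y) = (r\<^sup>2 + t * r + 1) * y\<^sup>2" for r y
    by (simp add: n_def power2_eq_square algebra_simps)
  \<comment> \<open>The zeros of the form make up one line through the origin for each root
    \<open>r\<close>.\<close>
  have "bij_betw (\<lambda>(r, y). (r * y, y)) ({r. r\<^sup>2 + t * r + 1 = 0} \<times> (UNIV - {0})) ({v. n v = 0} - {(0, 0)})"
  proof (rule bij_betwI[of _ _ _ "\<lambda>(x, y). (x / y, y)"])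
    show "(\<lambda>(r, y). (r * y, y)) \<in> {r. r\<^sup>2 + t * r + 1 = 0} \<times> (UNIV - {0}) \<rightarrow> {v. n v = 0} - {(0, 0)}"
      by (auto simp: n_root)
    have root: "y \<noteq> 0 \<and> (x / y)\<^sup>2 + t * (x / y) + 1 = 0"
      if "(x, y) \<in> {v. n v = 0} - {(0, 0)}" for x y
    proof -
      \<comment> \<open>For \<open>y = 0\<close> the form is x^2, which vanishes only at the
        origin.\<close>
      have "y \<noteq> 0" using that by (auto simp: n_def)
      then show ?thesis using n_root[of "x / y" y] that by simp
    qed
    show "(\<lambda>(x, y). (x / y, y)) \<in> {v. n v = 0} - {(0, 0)} \<rightarrow> {r. r\<^sup>2 + t * r + 1 = 0} \<times> (UNIV - {0})"
      by (intro Pi_I, unfold split_paired_all split_conv) (use root in blast)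
    show "(case case v of (x, y) \<Rightarrow> (x / y, y) of (r, y) \<Rightarrow> (r * y, y)) = v"
      if "v \<in> {v. n v = 0} - {(0, 0)}" for v
      using root[of "fst v" "snd v"] that by (cases v) simp
  qed auto
  then have "card ({v. n v = 0} - {(0, 0)}) = trace_roots t * (q - 1)"
    by (auto dest!: bij_betw_same_card simp: card_cartesian_product trace_roots_def q_def card_Diff_subset)
  moreover have "(0, 0) \<in> {v. n v = 0}" by (simp add: n_def)
  ultimately have zero: "card {v. n v = 0} = 1 + trace_roots t * (q - 1)"
    by (metis fin card.remove plus_1_eq_Suc)
  have "q * q = card (UNIV :: ('a \<times> 'a) set)"
    by (simp add: q_def)
  also have "\<dots> = card ({v. n v \<noteq> 0} \<union> {v. n v = 0})"
    by (rule arg_cong[of _ _ card]) auto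
  also have "\<dots> = card {v. n v \<noteq> 0} + card {v. n v = 0}"
    by (rule card_Un_disjoint) auto
  finally have "q * q = card {v. n v \<noteq> 0} + card {v. n v = 0}" .
  then have "q * q = (q - 1) * (card {v. n v = 1} + trace_roots t) + 1"
    using nonzero zero by (simp add: algebra_simps)
  moreover have "q * q = (q - 1) * (q + 1) + 1"
    using q_gt_1 by (cases q) auto
  ultimately have "(q - 1) * (card {v. n v = 1} + trace_roots t) = (q - 1) * (q + 1)"
    by simp
  then have "card {v. n v = 1} + trace_roots t = q + 1"
    using q_gt_1 by (simp only: mult_cancel1) auto
  moreover have "{v. n v = 1} = {(x, y). x\<^sup>2 + t * x * y + y\<^sup>2 = 1}"
    by (auto simp: n_def)
  ultimately show ?thesis by simp
qed

subsection \<open>Commuting matrices of determinant 1\<close>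

text \<open>The quadruple \<open>(a, b, c, d)\<close> stands for the matrix with rows \<open>(a, b)\<close> and \<open>(c, d)\<close>.
  In characteristic 2 its determinant is \<open>a d + b c\<close>, and \<open>a - d\<close> is the trace \<open>a + d\<close>.\<close>

definition sl2 :: "('a \<times> 'a \<times> 'a \<times> 'a) set" where
  "sl2 = {(a, b, c, d). a * d + b * c = 1}"

definition sl2_trace :: "'a \<times> 'a \<times> 'a \<times> 'a \<Rightarrow> 'a" where
  "sl2_trace = (\<lambda>(a, b, c, d). a + d)"

text \<open>Two matrices commute iff their vectors \<open>(b, c, a - d)\<close> are parallel.\<close>

fun commute :: "'a \<times> 'a \<times> 'a \<times> 'a \<Rightarrow> 'a \<times> 'a \<times> 'a \<times> 'a \<Rightarrow> bool" where
  "commute (a, b, c, d) (e, f, g, h) \<longleftrightarrow>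
    b * g = c * f \<and> (a + d) * f = (e + h) * b \<and> (a + d) * g = (e + h) * c"

lemma finite_quadruples [simp]: "finite (A :: ('a \<times> 'a \<times> 'a \<times> 'a) set)"
  by (rule finite_subset[OF subset_UNIV]) (intro finite_Prod_UNIV finite_UNIV)

text \<open>A scalar matrix of determinant 1 has a^2 = 1, and injectivity of squaring leaves only
  the identity.\<close>

lemma nonscalar:
  assumes "(a, b, c, d) \<in> sl2" "(a, b, c, d) \<noteq> (1, 0, 0, 1)"
  shows "b \<noteq> 0 \<or> c \<noteq> 0 \<or> a + d \<noteq> 0"
proof (rule ccontr)
  assume "\<not> ?thesis"
  then have "b = 0" "c = 0" "d = a" by (simp_all add: add_eq_0_iff_eq)
  then have "a\<^sup>2 = 1\<^sup>2" using assms by (simp add: sl2_def power2_eq_square)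
  then have "a = 1" by (simp only: square_eq_iff)
  then show False using assms \<open>b = 0\<close> \<open>c = 0\<close> \<open>d = a\<close> by simp
qed

text \<open>The equations say that all 2 by 2 minors of the two vectors vanish; the factor is found
  by dividing at a nonzero coordinate of the first.\<close>

lemma parallel_imp_multiple:
  fixes b c s f g r :: 'a
  assumes "b \<noteq> 0 \<or> c \<noteq> 0 \<or> s \<noteq> 0"
    and "b * g = c * f" "s * f = r * b" "s * g = r * c"
  shows "\<exists>y. f = y * b \<and> g = y * c \<and> r = y * s"
proof -
  consider "b \<noteq> 0" | "c \<noteq> 0" | "s \<noteq> 0" using assms(1) by blast
  then show ?thesis
  proof cases
    case 1
    then show ?thesis
      using assms(2-) by (intro exI[of _ "f / b"]) (auto simp: nonzero_eq_divide_eq mult.commute)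
  next
    case 2
    then show ?thesis
      using assms(2-) by (intro exI[of _ "g / c"]) (auto simp: nonzero_eq_divide_eq mult.commute)
  next
    case 3
    then show ?thesis
      using assms(2-) by (intro exI[of _ "r / s"]) (auto simp: nonzero_eq_divide_eq mult.commute)
  qed
qed

lemma commute_refl: "commute u u"
  by (cases u) (simp add: mult.commute)

lemma commute_sym: "commute u v \<Longrightarrow> commute v u"
  by (cases u; cases v) (auto simp: mult.commute)

text \<open>As \<open>v\<close> is not scalar, its vector spans a line, on which the vectors of
  \<open>u\<close> and \<open>w\<close> both lie.\<close>

lemma commute_trans:
  assumes "v \<in> sl2" "v \<noteq> (1, 0, 0, 1)" "commute v u" "commute v w"
  shows "commute u w"
proof -
  obtain a b c d where v: "v = (a, b, c, d)" by (cases v)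
  obtain e f g h where u: "u = (e, f, g, h)" by (cases u)
  obtain e' f' g' h' where w: "w = (e', f', g', h')" by (cases w)
  have ns: "b \<noteq> 0 \<or> c \<noteq> 0 \<or> a + d \<noteq> 0"
    using nonscalar assms v by blast
  have "b * g = c * f" "(a + d) * f = (e + h) * b" "(a + d) * g = (e + h) * c"
    using assms by (simp_all add: v u)
  then obtain y where "f = y * b" "g = y * c" "e + h = y * (a + d)"
    using parallel_imp_multiple[OF ns] by blast
  moreover have "b * g' = c * f'" "(a + d) * f' = (e' + h') * b" "(a + d) * g' = (e' + h') * c"
    using assms by (simp_all add: v w)
  then obtain z where "f' = z * b" "g' = z * c" "e' + h' = z * (a + d)"
    using parallel_imp_multiple[OF ns] by blast
  ultimately show ?thesis by (simp add: u w mult_ac)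
qed

text \<open>The centralizer of a nonscalar matrix A consists of the x + y A, and the determinant of
  x + y A is the quadratic form counted above.\<close>

lemma commute_class:
  assumes "(a, b, c, d) \<in> sl2" "(a, b, c, d) \<noteq> (1, 0, 0, 1)"
  shows "bij_betw (\<lambda>(x, y). (x + y * a, y * b, y * c, x + y * d))
    {(x, y). x\<^sup>2 + (a + d) * x * y + y\<^sup>2 = 1} {u \<in> sl2. commute (a, b, c, d) u}"
proof (rule bij_betw_imageI)
  note ns = nonscalar[OF assms]
  have det: "(x + y * a) * (x + y * d) + y * b * (y * c) = x\<^sup>2 + (a + d) * x * y + y\<^sup>2" for x y
  proof -
    have "(x + y * a) * (x + y * d) + y * b * (y * c) =
        x\<^sup>2 + (a + d) * x * y + y\<^sup>2 * (a * d + b * c)"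
      by (simp add: power2_eq_square algebra_simps)
    then show ?thesis using assms by (simp add: sl2_def)
  qed
  have sum: "x + y * a + (x + y * d) = y * (a + d)" for x y
    by (simp add: algebra_simps)
  show "inj_on (\<lambda>(x, y). (x + y * a, y * b, y * c, x + y * d)) {(x, y). x\<^sup>2 + (a + d) * x * y + y\<^sup>2 = 1}"
  proof (rule inj_onI, clarify)
    fix x y x' y'
    assume 1: "x + y * a = x' + y' * a" "y * b = y' * b" "y * c = y' * c" "x + y * d = x' + y' * d"
    then have "y * (a + d) = y' * (a + d)" using sum by metis
    then have "y = y'" using ns 1 by auto
    then show "x = x' \<and> y = y'" using 1 by simp
  qed
  show "(\<lambda>(x, y). (x + y * a, y * b, y * c, x + y * d)) ` {(x, y). x\<^sup>2 + (a + d) * x * y + y\<^sup>2 = 1} =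
    {u \<in> sl2. commute (a, b, c, d) u}"
  proof (intro equalityI subsetI)
    fix u assume "u \<in> (\<lambda>(x, y). (x + y * a, y * b, y * c, x + y * d)) ` {(x, y). x\<^sup>2 + (a + d) * x * y + y\<^sup>2 = 1}"
    then obtain x y where u: "u = (x + y * a, y * b, y * c, x + y * d)"
      and norm: "x\<^sup>2 + (a + d) * x * y + y\<^sup>2 = 1" by auto
    have "u \<in> sl2"
      unfolding u sl2_def mem_Collect_eq prod.case det norm ..
    moreover have "commute (a, b, c, d) u"
      unfolding u commute.simps sum by (simp add: mult_ac)
    ultimately show "u \<in> {u \<in> sl2. commute (a, b, c, d) u}" by blast
  next
    fix u assume u: "u \<in> {u \<in> sl2. commute (a, b, c, d) u}"
    obtain e f g h where u_eq: "u = (e, f, g, h)" by (cases u)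
    have "b * g = c * f" "(a + d) * f = (e + h) * b" "(a + d) * g = (e + h) * c"
      using u by (simp_all add: u_eq)
    then obtain y where y: "f = y * b" "g = y * c" "e + h = y * (a + d)"
      using parallel_imp_multiple[OF ns] by blast
    \<comment> \<open>The first diagonal entry forces \<open>x\<close>; the second is then recovered
      from the trace \<open>e + h\<close>.\<close>
    define x where "x = e + y * a"
    have e: "e = x + y * a" by (simp add: x_def add.assoc)
    have "h = e + (e + h)" by simp
    also have "\<dots> = x + y * d"
      unfolding y(3) by (simp add: x_def distrib_left add.assoc)
    finally have h: "h = x + y * d" .
    have "x\<^sup>2 + (a + d) * x * y + y\<^sup>2 = 1"
      using u unfolding u_eq y e h sl2_def by (simp add: det[symmetric])
    then show "u \<in> (\<lambda>(x, y). (x + y * a, y * b, y * c, x + y * d)) ` {(x, y). x\<^sup>2 + (a + d) * x * y + y\<^sup>2 = 1}"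
      unfolding u_eq y(1,2) e h by force
  qed
qed

text \<open>The norm equation has q + 1 - r solutions, one of which is the excluded
  identity.\<close>

lemma card_commute_class:
  assumes "v \<in> sl2 - {(1, 0, 0, 1)}"
  shows "card {u \<in> sl2 - {(1, 0, 0, 1)}. commute v u} = q - trace_roots (sl2_trace v)"
proof -
  obtain a b c d where v: "v = (a, b, c, d)" by (cases v)
  have "{u \<in> sl2 - {(1, 0, 0, 1)}. commute v u} = {u \<in> sl2. commute v u} - {(1, 0, 0, 1)}"
    by auto
  also have "card \<dots> = card {u \<in> sl2. commute v u} - 1"
    by (intro card_Diff_singleton) (simp add: v sl2_def)
  also have "card {u \<in> sl2. commute v u} =
      card {(x, y). x\<^sup>2 + (a + d) * x * y + y\<^sup>2 = 1}"
    using commute_class[of a b c d] assms v by (auto dest: bij_betw_same_card)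
  finally show ?thesis
    using card_norm_eq_1[of "a + d"] by (simp add: v sl2_trace_def)
qed

section \<open>Counting the matrices of a given trace\<close>

lemma card_hyperbola:
  "card {(b, c). b * c = (z :: 'a)} = (q - 1) + (if z = 0 then q else 0)"
proof (cases "z = 0")
  case True
  have "{(b, c). b * c = z} = {0} \<times> UNIV \<union> (UNIV - {0}) \<times> {0}"
    using True by auto
  also have "card \<dots> = q + (q - 1)"
    by (subst card_Un_disjoint) (auto simp: card_cartesian_product q_def card_Diff_subset)
  finally show ?thesis using True by simp
next
  case False
  have "bij_betw fst {(b, c). b * c = z} (UNIV - {0})"
    by (rule bij_betwI[of _ _ _ "\<lambda>b. (b, z / b)"]) (use False in auto)
  then show ?thesis
    using False by (auto dest!: bij_betw_same_card simp: q_def card_Diff_subset)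
qed

text \<open>For fixed \<open>a\<close> and \<open>t\<close>, the pairs \<open>(b, c)\<close> form a
  hyperbola, which degenerates into two lines when \<open>a\<close> is one of the roots.\<close>

lemma card_sl2_trace_eq: "card {u \<in> sl2. sl2_trace u = t} = q * (q - 1) + q * trace_roots t"
proof -
  have "bij_betw (\<lambda>(a, b, c). (a, b, c, a + t))
    (SIGMA a:UNIV. {(b, c). b * c = a\<^sup>2 + t * a + 1}) {u \<in> sl2. sl2_trace u = t}"
  proof (rule bij_betwI[of _ _ _ "\<lambda>(a, b, c, d). (a, b, c)"])
    have "a * (a + t) + b * c = 1" if "b * c = a\<^sup>2 + t * a + 1" for a b c
      unfolding that by (simp add: power2_eq_square distrib_left mult.commute flip: add.assoc)
    then show "(\<lambda>(a, b, c). (a, b, c, a + t)) \<in>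
        (SIGMA a:UNIV. {(b, c). b * c = a\<^sup>2 + t * a + 1}) \<rightarrow> {u \<in> sl2. sl2_trace u = t}"
      by (auto simp: sl2_def sl2_trace_def)
    have "b * c = a\<^sup>2 + (a + d) * a + 1" if "a * d + b * c = 1" for a b c d :: 'a
    proof -
      have "b * c = a * d + (a * d + b * c)" by (rule add_self_cancel[symmetric])
      then show ?thesis
        unfolding that by (simp add: power2_eq_square distrib_left distrib_right mult.commute add.assoc)
    qed
    then show "(\<lambda>(a, b, c, d). (a, b, c)) \<in> {u \<in> sl2. sl2_trace u = t} \<rightarrow>
        (SIGMA a:UNIV. {(b, c). b * c = a\<^sup>2 + t * a + 1})"
      by (auto simp: sl2_def sl2_trace_def)
  qed (auto simp: sl2_trace_def)
  then have "card {u \<in> sl2. sl2_trace u = t} =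
      card (SIGMA a:UNIV. {(b, c). b * c = a\<^sup>2 + t * a + 1})"
    by (simp add: bij_betw_same_card)
  also have "\<dots> = (\<Sum>a\<in>UNIV. card {(b, c). b * c = a\<^sup>2 + t * a + 1})"
    by (rule card_SigmaI) (auto intro: finite_subset[OF subset_UNIV] finite_Prod_UNIV finite_UNIV)
  also have "\<dots> = q * (q - 1) + q * trace_roots t"
    by (simp add: card_hyperbola sum.distrib sum.If_cases trace_roots_def q_def)
  finally show ?thesis .
qed

lemma card_sl2_trace_in:
  "card {u \<in> sl2. sl2_trace u \<in> T} = (\<Sum>t\<in>T. q * (q - 1) + q * trace_roots t)"
proof -
  have "{u \<in> sl2. sl2_trace u \<in> T} = (\<Union>t\<in>T. {u \<in> sl2. sl2_trace u = t})" by auto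
  also have "card \<dots> = (\<Sum>t\<in>T. card {u \<in> sl2. sl2_trace u = t})"
    by (rule card_UN_disjoint) auto
  finally show ?thesis by (simp add: card_sl2_trace_eq)
qed

end

section \<open>The group \<open>PSL(2, q)\<close> for even \<open>q\<close>\<close>

lemma det_2_2:
  assumes "A \<in> carrier_mat 2 2"
  shows "det A = A $$ (0,0) * A $$ (1,1) - A $$ (0,1) * A $$ (1,0)"
proof -
  have "det A = (\<Sum>i<2. A $$ (i,0) * cofactor A i 0)"
    using laplace_expansion_column[OF assms, of 0] by simp
  also have "\<dots> = A $$ (0,0) * A $$ (1,1) - A $$ (0,1) * A $$ (1,0)"
    using assms by (simp add: numeral_2_eq_2 cofactor_def mat_delete_def det_single)
  finally show ?thesis .
qed

definition mat_2_2_of :: "'a::field \<times> 'a \<times> 'a \<times> 'a \<Rightarrow> 'a mat" where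
  "mat_2_2_of = (\<lambda>(a, b, c, d). mat 2 2
    (\<lambda>(i, j). if i = 0 then if j = 0 then a else b else if j = 0 then c else d))"

lemma mat_2_2_of_carrier [simp]: "mat_2_2_of u \<in> carrier_mat 2 2"
  by (cases u) (simp add: mat_2_2_of_def)

lemma mat_2_2_of_eq_iff: "mat_2_2_of u = mat_2_2_of v \<longleftrightarrow> u = v"
proof
  assume "mat_2_2_of u = mat_2_2_of v"
  then have "mat_2_2_of u $$ (i, j) = mat_2_2_of v $$ (i, j)" for i j by simp
  from this[of 0 0] this[of 0 1] this[of 1 0] this[of 1 1] show "u = v"
    by (cases u; cases v) (simp add: mat_2_2_of_def)
qed simp

lemma carrier_mat_2_2_eq: "carrier_mat 2 2 = range (mat_2_2_of :: _ \<Rightarrow> 'a::field mat)"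
proof
  show "carrier_mat 2 2 \<subseteq> range (mat_2_2_of :: _ \<Rightarrow> 'a mat)"
  proof
    fix A :: "'a mat" assume "A \<in> carrier_mat 2 2"
    then have "A = mat_2_2_of (A $$ (0, 0), A $$ (0, 1), A $$ (1, 0), A $$ (1, 1))"
      by (intro eq_matI) (auto simp: mat_2_2_of_def numeral_2_eq_2 less_Suc_eq)
    then show "A \<in> range mat_2_2_of" by blast
  qed
qed auto

lemma det_mat_2_2_of: "det (mat_2_2_of (a, b, c, d)) = a * d - b * c"
  by (subst det_2_2[OF mat_2_2_of_carrier]) (simp add: mat_2_2_of_def)

lemma mat_2_2_of_mult:
  "mat_2_2_of (a, b, c, d) * mat_2_2_of (e, f, g, h) =
    mat_2_2_of (a * e + b * g, a * f + b * h, c * e + d * g, c * f + d * h)"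
  by (rule eq_matI)
    (auto simp: mat_2_2_of_def scalar_prod_def numeral_2_eq_2 less_Suc_eq)

lemma one_mat_2: "1\<^sub>m 2 = mat_2_2_of (1, 0, 0, 1)"
  by (rule eq_matI) (auto simp: mat_2_2_of_def numeral_2_eq_2 less_Suc_eq)

context finite_field_char_2 begin

lemma carrier_SL_2: "carrier (SL 2 :: 'a mat monoid) = mat_2_2_of ` sl2"
  by (auto simp: special_linear_group_def carrier_mat_2_2_eq det_mat_2_2_of sl2_def)

text \<open>Both diagonal entries of the two products agree iff \<open>b * g = c * f\<close>; the
  off-diagonal ones give the two equations with traces.\<close>

lemma commute_iff: "mat_2_2_of u * mat_2_2_of v = mat_2_2_of v * mat_2_2_of u \<longleftrightarrow> commute u (v :: 'a \<times> 'a \<times> 'a \<times> 'a)"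
proof -
  obtain a b c d where u: "u = (a, b, c, d)" by (cases u)
  obtain e f g h where v: "v = (e, f, g, h)" by (cases v)
  have eq: "x = y \<longleftrightarrow> x + y = 0" for x y :: 'a by (simp add: add_eq_0_iff_eq)
  have "a * e + b * g = e * a + f * c \<longleftrightarrow> b * g = c * f"
    by (simp add: mult.commute)
  moreover have "a * f + b * h = e * b + f * d \<longleftrightarrow> (a + d) * f = (e + h) * b"
    by (subst (1 2) eq) (simp add: algebra_simps)
  moreover have "c * e + d * g = g * a + h * c \<longleftrightarrow> (a + d) * g = (e + h) * c"
    by (subst (1 2) eq) (simp add: algebra_simps)
  moreover have "c * f + d * h = g * b + h * d \<longleftrightarrow> b * g = c * f"
    by (auto simp: mult.commute)
  ultimately show ?thesis
    unfolding u v mat_2_2_of_mult mat_2_2_of_eq_iff commute.simps prod.inject by blast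
qed

lemma sl2_center: "{u \<in> sl2. \<forall>v\<in>sl2. commute u v} = {(1, 0, 0, 1)}"
proof -
  have "u = (1, 0, 0, 1)" if "u \<in> sl2" "\<forall>v\<in>sl2. commute u v" for u
  proof -
    obtain a b c d where u: "u = (a, b, c, d)" by (cases u)
    \<comment> \<open>Commuting with these two transvections already forces \<open>b\<close>,
      \<open>c\<close> and \<open>a + d\<close> to be 0.\<close>
    have "commute u (1, 1, 0, 1)" "commute u (1, 0, 1, 1)"
      using that by (auto simp: sl2_def)
    then show ?thesis using nonscalar[of a b c d] that by (auto simp: u)
  qed
  moreover have "(1, 0, 0, 1) \<in> sl2" "\<forall>v\<in>sl2. commute (1, 0, 0, 1) v"
    by (auto simp: sl2_def)
  ultimately show ?thesis by blast
qed

lemma group_center_SL_2: "group_center (SL 2 :: 'a mat monoid) = {1\<^sub>m 2}"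
proof -
  have "group_center (SL 2 :: 'a mat monoid) = mat_2_2_of ` {u \<in> sl2. \<forall>v\<in>sl2. commute u v}"
    unfolding group_center_def carrier_SL_2
    by (simp add: special_linear_group_def commute_iff Compr_image_eq)
  then show ?thesis by (simp add: sl2_center one_mat_2)
qed

text \<open>The centre of SL(2, q) is trivial here, so the cosets forming PSL(2, q) are
  singletons.\<close>

definition psl :: "'a \<times> 'a \<times> 'a \<times> 'a \<Rightarrow> 'a mat set" where "psl u = {mat_2_2_of u}"

lemma psl_eq_iff [simp]: "psl u = psl v \<longleftrightarrow> u = v"
  by (simp add: psl_def mat_2_2_of_eq_iff)

lemma carrier_PSL_2: "carrier (PSL 2 :: 'a mat set monoid) = psl ` sl2"
proof -
  have "1\<^sub>m 2 * mat_2_2_of u = mat_2_2_of u" for u :: "'a \<times> 'a \<times> 'a \<times> 'a"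
    by (rule left_mult_one_mat[OF mat_2_2_of_carrier])
  then show ?thesis
    by (auto simp: projective_special_linear_group_def FactGroup_def RCOSETS_def r_coset_def
        group_center_SL_2 carrier_SL_2 psl_def special_linear_group_def[THEN arg_cong[of _ _ monoid.mult]])
qed

lemma mult_PSL_2: "psl u \<otimes>\<^bsub>PSL 2\<^esub> psl v = {mat_2_2_of u * mat_2_2_of v}"
  by (simp add: projective_special_linear_group_def FactGroup_def set_mult_def psl_def
      special_linear_group_def[THEN arg_cong[of _ _ monoid.mult]])

lemma commute_PSL_2: "psl u \<otimes>\<^bsub>PSL 2\<^esub> psl v = psl v \<otimes>\<^bsub>PSL 2\<^esub> psl u \<longleftrightarrow> commute u v"
  by (simp add: mult_PSL_2 commute_iff)

lemma group_center_PSL_2: "group_center (PSL 2 :: 'a mat set monoid) = {psl (1, 0, 0, 1)}"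
proof -
  have "group_center (PSL 2 :: 'a mat set monoid) = psl ` {u \<in> sl2. \<forall>v\<in>sl2. commute u v}"
    unfolding group_center_def carrier_PSL_2 by (simp add: commute_PSL_2 Compr_image_eq)
  then show ?thesis by (simp add: sl2_center)
qed

section \<open>The commuting classes as parts of the non-commuting graph\<close>

lemma pverts_PSL_2:
  "pverts (noncommuting_graph (PSL 2 :: 'a mat set monoid)) = psl ` (sl2 - {(1, 0, 0, 1)})"
  by (auto simp: noncommuting_graph_def carrier_PSL_2 group_center_PSL_2)

text \<open>Serves as the label of the part containing a vertex: the class itself stands in for an
  abstract quotient.\<close>

definition centralizer_class :: "'a mat set \<Rightarrow> 'a mat set set" where
  "centralizer_class X = {Y \<in> psl ` (sl2 - {(1, 0, 0, 1)}). X \<otimes>\<^bsub>PSL 2\<^esub> Y = Y \<otimes>\<^bsub>PSL 2\<^esub> X}"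

lemma centralizer_class_psl:
  "centralizer_class (psl u) = psl ` {v \<in> sl2 - {(1, 0, 0, 1)}. commute u v}"
  by (simp add: centralizer_class_def Compr_image_eq commute_PSL_2)

lemma centralizer_class_eq_iff:
  assumes "u \<in> sl2 - {(1, 0, 0, 1)}" "v \<in> sl2 - {(1, 0, 0, 1)}"
  shows "centralizer_class (psl u) = centralizer_class (psl v) \<longleftrightarrow> commute u v"
proof
  assume "centralizer_class (psl u) = centralizer_class (psl v)"
  moreover have "psl v \<in> centralizer_class (psl v)"
    using assms by (auto simp: centralizer_class_psl commute_refl)
  ultimately have "psl v \<in> centralizer_class (psl u)" by simp
  then show "commute u v"
    unfolding centralizer_class_psl by auto
next
  assume uv: "commute u v"
  have "commute u w \<longleftrightarrow> commute v w" for w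
    using commute_trans[of u v w] commute_trans[of v u w] commute_sym[OF uv] uv assms by blast
  then show "centralizer_class (psl u) = centralizer_class (psl v)"
    by (simp add: centralizer_class_psl)
qed

lemma card_centralizer_class_fibre:
  assumes "u \<in> sl2 - {(1, 0, 0, 1)}"
  shows "card {X \<in> psl ` (sl2 - {(1, 0, 0, 1)}). centralizer_class X = centralizer_class (psl u)} =
    q - trace_roots (sl2_trace u)"
proof -
  have "{X \<in> psl ` (sl2 - {(1, 0, 0, 1)}). centralizer_class X = centralizer_class (psl u)} =
      psl ` {v \<in> sl2 - {(1, 0, 0, 1)}. commute u v}"
    using assms centralizer_class_eq_iff[OF assms] by (force simp: Compr_image_eq)
  also have "card \<dots> = q - trace_roots (sl2_trace u)"
    using card_commute_class[OF assms] by (simp add: card_image inj_on_def)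
  finally show ?thesis .
qed

text \<open>Both numbers of roots are at most 2, so for \<open>q \<ge> 4\<close> the subtraction is
  not truncated and class sizes determine numbers of roots.\<close>

lemma diff_trace_roots_eq_iff:
  assumes "q \<ge> 4" "r \<le> 2"
  shows "q - trace_roots (t :: 'a) = q - r \<longleftrightarrow> trace_roots t = r"
proof -
  have "trace_roots t \<le> 2"
    using trace_roots_0 trace_roots_nonzero[of t] by (cases "t = 0") auto
  then show ?thesis using assms by auto
qed

lemma trace_roots_eq_1_iff: "trace_roots (t :: 'a) = 1 \<longleftrightarrow> t = 0"
  using trace_roots_0 trace_roots_nonzero[of t] by (cases "t = 0") auto

text \<open>The identity has trace 0, hence one root, so excluding it does not affect the count for
  other \<open>r\<close>.\<close>

lemma card_trace_roots_eq:
  assumes "r \<noteq> 1"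
  shows "card {u \<in> sl2 - {(1, 0, 0, 1)}. trace_roots (sl2_trace u) = r} =
    card {t :: 'a. trace_roots t = r} * (q * (q - 1) + q * r)"
proof -
  have "{u \<in> sl2 - {(1, 0, 0, 1)}. trace_roots (sl2_trace u) = r} =
      {u \<in> sl2. sl2_trace u \<in> {t. trace_roots t = r}}"
    using assms trace_roots_0 by (auto simp: sl2_trace_def)
  then have "card {u \<in> sl2 - {(1, 0, 0, 1)}. trace_roots (sl2_trace u) = r} =
      (\<Sum>t\<in>{t :: 'a. trace_roots t = r}. q * (q - 1) + q * trace_roots t)"
    by (simp only: card_sl2_trace_in)
  also have "\<dots> = (\<Sum>t\<in>{t :: 'a. trace_roots t = r}. q * (q - 1) + q * r)"
    by (rule sum.cong) auto
  finally show ?thesis by simp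
qed

text \<open>One root means trace 0, which leaves q (q - 1) + q matrices including the
  identity.\<close>

lemma card_trace_roots_eq_1:
  "card {u \<in> sl2 - {(1, 0, 0, 1)}. trace_roots (sl2_trace u) = 1} = q * q - 1"
proof -
  have "{u \<in> sl2 - {(1, 0, 0, 1)}. trace_roots (sl2_trace u) = 1} =
      {u \<in> sl2. sl2_trace u = 0} - {(1, 0, 0, 1)}"
    by (auto simp: trace_roots_eq_1_iff simp del: One_nat_def)
  also have "card \<dots> = card {u \<in> sl2. sl2_trace u = 0} - 1"
    by (intro card_Diff_singleton) (simp add: sl2_def sl2_trace_def)
  finally show ?thesis
    using q_gt_1 by (simp add: card_sl2_trace_eq trace_roots_0 algebra_simps)
qed

text \<open>The numbers \<open>k0\<close>, \<open>k1\<close>, \<open>k2\<close> arise as the numbers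
  of classes of size \<open>q\<close>, \<open>q - 1\<close>, \<open>q - 2\<close>; adding the
  identity makes these the centralizers of order q + 1, q, q - 1.\<close>

lemma laplacian_spectrum_PSL_2:
  fixes vs :: "'a mat set list"
  assumes q4: "q \<ge> 4" and "distinct vs"
    and vs: "set vs = pverts (noncommuting_graph (PSL 2 :: 'a mat set monoid))"
  obtains k0 k1 k2 where
    "2 * k0 = q * (q - 1)" "k1 = q + 1" "2 * k2 = q * (q + 1)"
    "laplacian_spectrum (noncommuting_graph (PSL 2 :: 'a mat set monoid)) vs = {#0#}
    + replicate_mset (k0 + k1 + k2 - 1) (of_nat (k0 * q + k1 * (q - 1) + k2 * (q - 2)))
    + replicate_mset (k0 * (q - 1)) (of_nat (k0 * q + k1 * (q - 1) + k2 * (q - 2)) - of_nat q)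
    + replicate_mset (k1 * (q - 2)) (of_nat (k0 * q + k1 * (q - 1) + k2 * (q - 2)) - of_nat (q - 1))
    + replicate_mset (k2 * (q - 3)) (of_nat (k0 * q + k1 * (q - 1) + k2 * (q - 2)) - of_nat (q - 2))"
proof -
  define V where "V = psl ` (sl2 - {(1, 0, 0, 1)})"
  define m where "m = (\<lambda>x. card {X \<in> V. centralizer_class X = x})"
  \<comment> \<open>The index of \<open>K\<close> is the number of roots shared by the matrices of a
    class.\<close>
  define K where "K = (\<lambda>r. {x \<in> centralizer_class ` V. m x = q - r})"
  have V: "pverts (noncommuting_graph (PSL 2 :: 'a mat set monoid)) = V"
    by (simp add: pverts_PSL_2 V_def)
  have finV: "finite V" by (simp add: V_def)
  have m: "m (centralizer_class (psl u)) = q - trace_roots (sl2_trace u)"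
    if "u \<in> sl2 - {(1, 0, 0, 1)}" for u
    using card_centralizer_class_fibre[OF that] by (simp add: m_def V_def)
  have class_count: "card (K r) * (q - r) =
      card {u \<in> sl2 - {(1, 0, 0, 1)}. trace_roots (sl2_trace u) = r}" if "r \<le> 2" for r
  proof -
    have "card (K r) * (q - r) = card {X \<in> V. m (centralizer_class X) = q - r}"
      unfolding K_def m_def by (rule count_by_fibre_size[OF finV, symmetric])
    also have "{X \<in> V. m (centralizer_class X) = q - r} =
        psl ` {u \<in> sl2 - {(1, 0, 0, 1)}. trace_roots (sl2_trace u) = r}"
      unfolding V_def Compr_image_eq
      by (intro arg_cong[of _ _ "(`) psl"] Collect_cong conj_cong refl)
        (simp add: m diff_trace_roots_eq_iff[OF q4 that])
    finally show ?thesis by (simp add: card_image inj_on_def)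
  qed
  have k0: "2 * card (K 0) = q * (q - 1)"
  proof -
    have "card (K 0) * q = card {t :: 'a. trace_roots t = 0} * (q * (q - 1))"
      using class_count[of 0] card_trace_roots_eq[of 0] by simp
    then have "(2 * card (K 0)) * q = (2 * card {t :: 'a. trace_roots t = 0} * (q - 1)) * q"
      by (simp add: algebra_simps)
    then have "2 * card (K 0) = (2 * card {t :: 'a. trace_roots t = 0}) * (q - 1)"
      using q4 by simp
    also have "2 * card {t :: 'a. trace_roots t = 0} = q"
      using card_traces by simp
    finally show ?thesis .
  qed
  have k1: "card (K 1) = q + 1"
  proof -
    have "card (K 1) * (q - 1) = q * q - 1"
      using class_count[of 1] card_trace_roots_eq_1 by simp
    also have "\<dots> = (q + 1) * (q - 1)"
      by (simp add: algebra_simps)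
    finally show ?thesis using q4 by (simp only: mult_cancel2) auto
  qed
  have k2: "2 * card (K 2) = q * (q + 1)"
  proof -
    have "card (K 2) * (q - 2) = card {t :: 'a. trace_roots t = 2} * (q * (q - 1) + q * 2)"
      using class_count[of 2] card_trace_roots_eq[of 2] by simp
    also have "q * (q - 1) + q * 2 = q * (q + 1)"
      using q4 by (cases q) auto
    finally have "(2 * card (K 2)) * (q - 2) = q * (q + 1) * (2 * card {t :: 'a. trace_roots t = 2})"
      by simp
    also have "2 * card {t :: 'a. trace_roots t = 2} = q - 2"
      using card_traces by simp
    finally show ?thesis using q4 by (simp only: mult_cancel2) auto
  qed
  have classes: "centralizer_class ` V = K 0 \<union> (K 1 \<union> K 2)"
  proof -
    have roots: "trace_roots t \<in> {0, 1, 2}" for t :: 'a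
      using trace_roots_0 trace_roots_nonzero[of t] by (cases "t = 0") auto
    have "m (centralizer_class X) \<in> {q - 0, q - 1, q - 2}" if "X \<in> V" for X
    proof -
      obtain u where u: "u \<in> sl2 - {(1, 0, 0, 1)}" "X = psl u"
        using \<open>X \<in> V\<close> unfolding V_def by (rule imageE)
      then show ?thesis
        using roots[of "sl2_trace u"] m[OF u(1)] by auto
    qed
    then show ?thesis
      unfolding K_def by blast
  qed
  have finK: "finite (K r)" for r using finV by (simp add: K_def)
  have disj: "K 0 \<inter> (K 1 \<union> K 2) = {}" "K 1 \<inter> K 2 = {}"
    using q4 by (auto simp: K_def)
  \<comment> \<open>Generic in \<open>f\<close>, so as to yield the number of classes, the number of
    vertices and the multiset of eigenvalues.\<close>
  have sum_classes: "(\<Sum>x\<in>centralizer_class ` V. f (m x)) =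
      (\<Sum>x\<in>K 0. f q) + ((\<Sum>x\<in>K 1. f (q - 1)) + (\<Sum>x\<in>K 2. f (q - 2)))"
    for f :: "nat \<Rightarrow> 'x::comm_monoid_add"
  proof -
    have "(\<Sum>x\<in>K r. f (m x)) = (\<Sum>x\<in>K r. f (q - r))" for r
      by (intro sum.cong) (auto simp: K_def)
    then show ?thesis
      unfolding classes using finK disj by (simp add: sum.union_disjoint)
  qed
  have card_classes: "card (centralizer_class ` V) = card (K 0) + card (K 1) + card (K 2)"
    using sum_classes[of "\<lambda>_. 1 :: nat"] by simp
  have card_V: "card V = card (K 0) * q + card (K 1) * (q - 1) + card (K 2) * (q - 2)"
  proof -
    have "card V = (\<Sum>x\<in>centralizer_class ` V. m x)"
      using sum.image_gen[OF finV, of "\<lambda>_. 1 :: nat" centralizer_class] by (simp add: m_def)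
    then show ?thesis using sum_classes[of "\<lambda>x. x"] by simp
  qed
  have arcs: "parcs (noncommuting_graph (PSL 2 :: 'a mat set monoid)) =
      {(X, Y). X \<in> pverts (noncommuting_graph (PSL 2)) \<and> Y \<in> pverts (noncommuting_graph (PSL 2))
        \<and> centralizer_class X \<noteq> centralizer_class Y}"
  proof -
    have iff: "X \<otimes>\<^bsub>PSL 2\<^esub> Y = Y \<otimes>\<^bsub>PSL 2\<^esub> X \<longleftrightarrow> centralizer_class X = centralizer_class Y"
      if XY: "X \<in> V" "Y \<in> V" for X Y
    proof -
      obtain u v where "u \<in> sl2 - {(1, 0, 0, 1)}" "X = psl u" "v \<in> sl2 - {(1, 0, 0, 1)}" "Y = psl v"
        using XY unfolding V_def by blast
      then show ?thesis by (simp only: commute_PSL_2 centralizer_class_eq_iff)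
    qed
    have "carrier (PSL 2) - group_center (PSL 2) = V"
      using V by (simp add: noncommuting_graph_def)
    then have "parcs (noncommuting_graph (PSL 2 :: 'a mat set monoid)) =
        {(X, Y). X \<in> V \<and> Y \<in> V \<and> X \<otimes>\<^bsub>PSL 2\<^esub> Y \<noteq> Y \<otimes>\<^bsub>PSL 2\<^esub> X}"
      by (simp add: noncommuting_graph_def)
    also have "\<dots> = {(X, Y). X \<in> V \<and> Y \<in> V \<and> centralizer_class X \<noteq> centralizer_class Y}"
      using iff by blast
    finally show ?thesis unfolding V .
  qed
  \<comment> \<open>A transvection shows that the graph has a vertex.\<close>
  have "psl (1, 1, 0, 1) \<in> V"
    by (auto simp: V_def sl2_def)
  then have "laplacian_spectrum (noncommuting_graph (PSL 2 :: 'a mat set monoid)) vs = {#0#}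
      + replicate_mset (card (centralizer_class ` V) - 1) (of_nat (card V))
      + (\<Sum>x\<in>centralizer_class ` V. replicate_mset (m x - 1) (of_nat (card V) - of_nat (m x)))"
    using laplacian_spectrum_complete_multipartite[OF \<open>distinct vs\<close> vs _ arcs]
    unfolding V m_def by blast
  also have "(\<Sum>x\<in>centralizer_class ` V. replicate_mset (m x - 1) (of_nat (card V) - of_nat (m x) :: complex)) =
      replicate_mset (card (K 0) * (q - 1)) (of_nat (card V) - of_nat q)
      + (replicate_mset (card (K 1) * (q - 2)) (of_nat (card V) - of_nat (q - 1))
      + replicate_mset (card (K 2) * (q - 3)) (of_nat (card V) - of_nat (q - 2)))"
    unfolding sum_classes[of "\<lambda>s. replicate_mset (s - 1) (of_nat (card V) - of_nat s)"]
      sum_constant_mset repeat_replicate_mset by (simp add: numeral_2_eq_2 numeral_3_eq_3)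
  finally show thesis
    using that[OF k0 k1 k2] unfolding card_classes card_V by (simp add: add.assoc)
qed

end

section \<open>Specialization to q = 2^k\<close>

theorem proposition4p3:
  fixes k :: nat and vs :: "'a::field mat set list"
  assumes "k \<ge> 2"
    and "CARD('a) = 2 ^ k"
    and "distinct vs"
    and "set vs = pverts (noncommuting_graph (PSL 2 :: 'a mat set monoid))"
  shows "laplacian_spectrum (noncommuting_graph (PSL 2 :: 'a mat set monoid)) vs =
      {#0#}
    + replicate_mset (2^(3*k-1) - 2^(2*k) + 2^(k-1)) (2^(3*k) - 2^(k+1) - 1)
    + replicate_mset (2^(2*k) - 2^k - 2) (2^(3*k) - 2^(k+1))
    + replicate_mset (2^(3*k-1) - 2^(2*k) - 3 * 2^(k-1)) (2^(3*k) - 2^(k+1) + 1)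
    + replicate_mset (2^(2*k) + 2^k) (2^(3*k) - 2^k - 1)"
proof -
  define q :: nat where q_pow: "q = 2 ^ k"
  \<comment> \<open>Half of \<open>q\<close> expresses the powers with exponents
    \<open>k - 1\<close> and \<open>3 * k - 1\<close>; writing \<open>h = j + 2\<close> later turns
    natural subtractions into polynomial identities in \<open>j\<close>.\<close>
  define h :: nat where "h = 2 ^ (k - 1)"
  obtain i where k: "k = i + 2" using \<open>k \<ge> 2\<close> by (metis add.commute le_Suc_ex)
  have qh: "q = 2 * h" by (simp add: q_pow h_def k)
  have "(2 :: nat) ^ 1 \<le> h" unfolding h_def by (rule power_increasing) (simp_all add: k)
  then obtain j where h: "h = j + 2" by (metis add.commute le_Suc_ex power_one_right)
  have q: "q = 2 * j + 4" by (simp add: qh h)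
  have pow: "(2 :: nat) ^ (3 * k - 1) = 4 * h ^ 3" "(2 :: nat) ^ (2 * k) = q\<^sup>2"
    by (simp_all add: h_def q_pow k flip: power_mult power_add)
      (simp_all add: power_add power_mult algebra_simps eval_nat_numeral)
  have pow': "(2 :: nat) ^ (k - 1) = h" "(2 :: nat) ^ k = q"
    by (simp_all add: h_def q_pow)
  have cpow: "(2 :: complex) ^ (3 * k) = of_nat q ^ 3" "(2 :: complex) ^ (k + 1) = 2 * of_nat q"
    "(2 :: complex) ^ k = of_nat q"
    by (simp_all add: q_pow mult.commute flip: power_mult)
  interpret finite_field_char_2 "TYPE('a)" q
  proof
    show "finite (UNIV :: 'a set)"
      by (rule card_ge_0_finite) (simp add: assms(2))
    show "q = CARD('a)" by (simp add: q_pow assms(2))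
    show "(2 :: 'a) = 0" using assms(2) by (rule card_eq_power_2_imp_two_eq_0)
  qed
  obtain k0 k1 k2 where k012: "2 * k0 = q * (q - 1)" "k1 = q + 1" "2 * k2 = q * (q + 1)"
    and spec: "laplacian_spectrum (noncommuting_graph (PSL 2 :: 'a mat set monoid)) vs = {#0#}
    + replicate_mset (k0 + k1 + k2 - 1) (of_nat (k0 * q + k1 * (q - 1) + k2 * (q - 2)))
    + replicate_mset (k0 * (q - 1)) (of_nat (k0 * q + k1 * (q - 1) + k2 * (q - 2)) - of_nat q)
    + replicate_mset (k1 * (q - 2)) (of_nat (k0 * q + k1 * (q - 1) + k2 * (q - 2)) - of_nat (q - 1))
    + replicate_mset (k2 * (q - 3)) (of_nat (k0 * q + k1 * (q - 1) + k2 * (q - 2)) - of_nat (q - 2))"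
    by (rule laplacian_spectrum_PSL_2[OF _ assms(3,4)]) (simp add: q)
  have k0: "k0 = (j + 2) * (2 * j + 3)" and k2: "k2 = (j + 2) * (2 * j + 5)"
    using k012 by (simp_all add: q algebra_simps)
  \<comment> \<open>The group has q^3 - q elements, and all but the identity are vertices; the
    additive form avoids truncated subtraction.\<close>
  have "k0 * q + k1 * (q - 1) + k2 * (q - 2) + q + 1 = q ^ 3"
    unfolding k0 k2 k012(2) by (simp add: q algebra_simps power3_eq_cube)
  then have "complex_of_nat (k0 * q + k1 * (q - 1) + k2 * (q - 2) + q + 1) = of_nat q ^ 3"
    by (simp only: of_nat_power)
  then have n: "complex_of_nat (k0 * q + k1 * (q - 1) + k2 * (q - 2)) = of_nat q ^ 3 - of_nat q - 1"
    unfolding of_nat_add of_nat_1 by (simp only: algebra_simps)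
  have cq: "complex_of_nat (q - 1) = of_nat q - 1" "complex_of_nat (q - 2) = of_nat q - 2"
    by (simp_all add: q of_nat_diff)
  have mult: "k0 + k1 + k2 - 1 = q\<^sup>2 + q" "k0 * (q - 1) = 4 * h ^ 3 - q\<^sup>2 + h"
    "k1 * (q - 2) = q\<^sup>2 - q - 2" "k2 * (q - 3) = 4 * h ^ 3 - q\<^sup>2 - 3 * h"
    unfolding k0 k2 k012(2)
    by (simp_all add: q h algebra_simps power2_eq_square power3_eq_cube)
  show ?thesis
    unfolding spec n cq mult pow pow' cpow by (simp add: algebra_simps)
qed
end
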